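(* Let $\Theta\subset\mathbb{R}^k$ be the parameter space, and assume that there is a unique $\beta_0\in\Theta$ for which the covariate balancing condition $$\mathbb{E}\left[\frac{D}{p(\mathbf X;\beta_0)}f(\mathbf X)\right]=\mathbb{E}\left[\frac{1-D}{1-p(\mathbf X;\beta_0)}f(\mathbf X)\right]=\mathbb{E}[f(\mathbf X)]\quad\text{for all measurable and integrable functions } f \text{ of } \mathbf X \qquad (\mathrm{CB})$$ is satisfied. Then $Q_w(\beta)\ge 0$ for all $\beta\in\Theta$, and $Q_w(\beta_0)=0$ if and only if the covariate balancing condition $(\mathrm{CB})$ holds.
   Context: $D$ is a binary ($\{0,1\}$-valued) random variable (treatment indicator), $\mathbf X$ is a random vector of covariates with values in $\mathbb{R}^k$, and $\{p(\cdot;\beta):\beta\in\Theta\}$, $\Theta\subset\mathbb{R}^k$, is a parametric model, with values in $(0,1)$, for the propensity score $p(\mathbf x)=\mathbb{P}(D=1\mid\mathbf X=\mathbf x)$. All expectations below are assumed to be well defined and finite. For $\beta\in\Theta$ put $$\varpi_1^{ps}(D,\mathbf X;\beta)=\frac{D}{p(\mathbf X;\beta)}\Big/\mathbb{E}\Big[\frac{D}{p(\mathbf X;\beta)}\Big],\qquad \varpi_0^{ps}(D,\mathbf X;\beta)=\frac{1-D}{1-p(\mathbf X;\beta)}\Big/\mathbb{E}\Big[\frac{1-D}{1-p(\mathbf X;\beta)}\Big],$$ $h_d(D,\mathbf X;\beta)=\varpi_d^{ps}(D,\mathbf X;\beta)-1$ for $d\in\{0,1\}$, and $\mathbf h=(h_1,h_0)'$.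 $\mathcal W=\{w(\cdot;\mathbf u):\mathbf u\in\Pi\}$ is a parametric family of (real- or complex-valued) weighting functions on the support of $\mathbf X$ such that the conditional restriction $\mathbb{E}[\mathbf h(D,\mathbf X;\beta)\mid\mathbf X]=\mathbf 0$ a.s. is equivalent to $\mathbb{E}[\mathbf h(D,\mathbf X;\beta)w(\mathbf X;\mathbf u)]=\mathbf 0$ for almost every $\mathbf u\in\Pi$. Examples are $w(\mathbf X;\mathbf u)=1\{\mathbf X\le\mathbf u\}$ (coordinatewise) with $\mathbf u\in[-\infty,\infty]^k$; $w(\mathbf X;\mathbf u)=\exp(i\mathbf u'\Phi(\mathbf X))$ with $\mathbf u\in\mathbb{R}^k$ and $\Phi$ a bounded one-to-one map from $\mathbb{R}^k$ to $\mathbb{R}^k$; and $w(\mathbf X;\mathbf u)=1\{\gamma'\mathbf X\le u\}$ with $\mathbf u=(\gamma,u)\in\mathbb{S}_k\times[-\infty,\infty]$, $\mathbb{S}_k=\{\gamma\in\mathbb{R}^k:\|\gamma\|=1\}$. "Almost every" is with respect to a dominating measure on $\Pi$, and $\Psi$ is a probability measure on $\Pi$ absolutely continuous with respect to that dominating measure. Define $$\mathbf H_w(\beta,\mathbf u)=\mathbb{E}[\mathbf h(D,\mathbf X;\beta)w(\mathbf X;\mathbf u)],\qquad Q_w(\beta)=\int_\Pi\|\mathbf H_w(\beta,\mathbf u)\|^2\,\Psi(d\mathbf u),$$ where $\|A\|^2=A^cA$ and $A^c$ denotes the conjugate transpose of the column vector $A$. *)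

theory Defs
  imports "HOL-Probability.Probability"
begin

text \<open>
  Throughout, \<open>D\<close> is the treatment indicator (as a real random variable), \<open>X\<close> the covariate
  vector, \<open>p x \<beta>\<close> the propensity score model, and \<open>w x u\<close> the weighting function. Real-valued
  weighting functions are covered through the embedding of the reals into the complex numbers.
\<close>

definition ps_weight1 ::
  "'a measure \<Rightarrow> ('a \<Rightarrow> real) \<Rightarrow> ('a \<Rightarrow> real^'k) \<Rightarrow> (real^'k \<Rightarrow> real^'k \<Rightarrow> real)
    \<Rightarrow> real^'k \<Rightarrow> 'a \<Rightarrow> real" where
  "ps_weight1 M D X p \<beta> \<omega> =
     (D \<omega> / p (X \<omega>) \<beta>) / (\<integral>\<omega>'. D \<omega>' / p (X \<omega>') \<beta> \<partial>M)"

definition ps_weight0 ::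
  "'a measure \<Rightarrow> ('a \<Rightarrow> real) \<Rightarrow> ('a \<Rightarrow> real^'k) \<Rightarrow> (real^'k \<Rightarrow> real^'k \<Rightarrow> real)
    \<Rightarrow> real^'k \<Rightarrow> 'a \<Rightarrow> real" where
  "ps_weight0 M D X p \<beta> \<omega> =
     ((1 - D \<omega>) / (1 - p (X \<omega>) \<beta>)) / (\<integral>\<omega>'. (1 - D \<omega>') / (1 - p (X \<omega>') \<beta>) \<partial>M)"

definition balance_h ::
  "'a measure \<Rightarrow> ('a \<Rightarrow> real) \<Rightarrow> ('a \<Rightarrow> real^'k) \<Rightarrow> (real^'k \<Rightarrow> real^'k \<Rightarrow> real)
    \<Rightarrow> real^'k \<Rightarrow> 'a \<Rightarrow> real^2" where
  "balance_h M D X p \<beta> \<omega> =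
     vector [ps_weight1 M D X p \<beta> \<omega> - 1, ps_weight0 M D X p \<beta> \<omega> - 1]"

text \<open>The integrand \<open>h w\<close>, a random vector in complex two-space.\<close>

definition weighted_h ::
  "'a measure \<Rightarrow> ('a \<Rightarrow> real) \<Rightarrow> ('a \<Rightarrow> real^'k) \<Rightarrow> (real^'k \<Rightarrow> real^'k \<Rightarrow> real)
    \<Rightarrow> (real^'k \<Rightarrow> 'u \<Rightarrow> complex) \<Rightarrow> real^'k \<Rightarrow> 'u \<Rightarrow> 'a \<Rightarrow> complex^2" where
  "weighted_h M D X p w \<beta> u \<omega> =
     (\<chi> i. complex_of_real (balance_h M D X p \<beta> \<omega> $ i) * w (X \<omega>) u)"

definition H_w ::
  "'a measure \<Rightarrow> ('a \<Rightarrow> real) \<Rightarrow> ('a \<Rightarrow> real^'k) \<Rightarrow> (real^'k \<Rightarrow> real^'k \<Rightarrow> real)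
    \<Rightarrow> (real^'k \<Rightarrow> 'u \<Rightarrow> complex) \<Rightarrow> real^'k \<Rightarrow> 'u \<Rightarrow> complex^2" where
  "H_w M D X p w \<beta> u = (\<integral>\<omega>. weighted_h M D X p w \<beta> u \<omega> \<partial>M)"

text \<open>
  The index set of the weighting family is the underlying space of \<open>\<Psi>\<close>. The library norm on
  complex vectors is the Hermitian one; see the lemma following the definition.
\<close>

definition Q_w ::
  "'a measure \<Rightarrow> ('a \<Rightarrow> real) \<Rightarrow> ('a \<Rightarrow> real^'k) \<Rightarrow> (real^'k \<Rightarrow> real^'k \<Rightarrow> real)
    \<Rightarrow> (real^'k \<Rightarrow> 'u \<Rightarrow> complex) \<Rightarrow> 'u measure \<Rightarrow> real^'k \<Rightarrow> real" where
  "Q_w M D X p w \<Psi> \<beta> = (\<integral>u. (norm (H_w M D X p w \<beta> u))\<^sup>2 \<partial>\<Psi>)"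

lemma norm_sq_eq_conjugate_transpose_mult:
  fixes A :: "complex^'n"
  shows "complex_of_real ((norm A)\<^sup>2) = (\<Sum>i\<in>UNIV. cnj (A $ i) * A $ i)"
proof -
  have "(norm A)\<^sup>2 = (\<Sum>i\<in>UNIV. (norm (A $ i))\<^sup>2)"
    by (simp add: norm_vec_def L2_set_def sum_nonneg)
  then show ?thesis
    by (simp add: complex_norm_square mult.commute del: of_real_power)
qed

text \<open>
  The restriction \<open>E[h | X] = 0\<close> almost surely, componentwise; conditioning on \<open>X\<close> means
  conditioning on the sigma-algebra generated by \<open>X\<close>.
\<close>

definition cond_balance ::
  "'a measure \<Rightarrow> ('a \<Rightarrow> real) \<Rightarrow> ('a \<Rightarrow> real^'k) \<Rightarrow> (real^'k \<Rightarrow> real^'k \<Rightarrow> real)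
    \<Rightarrow> real^'k \<Rightarrow> bool" where
  "cond_balance M D X p \<beta> \<longleftrightarrow>
     (\<forall>i. AE \<omega> in M. real_cond_exp M (vimage_algebra (space M) X borel)
                        (\<lambda>\<omega>'. balance_h M D X p \<beta> \<omega>' $ i) \<omega> = 0)"

text \<open>
  The covariate balancing condition. The integrability conjuncts are there because the library
  integral of a non-integrable function is 0: the condition is meant as an identity between
  expectations that exist and are finite.
\<close>

definition covariate_balance ::
  "'a measure \<Rightarrow> ('a \<Rightarrow> real) \<Rightarrow> ('a \<Rightarrow> real^'k) \<Rightarrow> (real^'k \<Rightarrow> real^'k \<Rightarrow> real)
    \<Rightarrow> real^'k \<Rightarrow> bool" where
  "covariate_balance M D X p \<beta> \<longleftrightarrow>
     (\<forall>f :: real^'k \<Rightarrow> real. f \<in> borel_measurable borel \<longrightarrow> integrable M (\<lambda>\<omega>. f (X \<omega>)) \<longrightarrow>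
        integrable M (\<lambda>\<omega>. D \<omega> / p (X \<omega>) \<beta> * f (X \<omega>)) \<and>
        integrable M (\<lambda>\<omega>. (1 - D \<omega>) / (1 - p (X \<omega>) \<beta>) * f (X \<omega>)) \<and>
        (\<integral>\<omega>. D \<omega> / p (X \<omega>) \<beta> * f (X \<omega>) \<partial>M)
          = (\<integral>\<omega>. (1 - D \<omega>) / (1 - p (X \<omega>) \<beta>) * f (X \<omega>) \<partial>M) \<and>
        (\<integral>\<omega>. (1 - D \<omega>) / (1 - p (X \<omega>) \<beta>) * f (X \<omega>) \<partial>M) = (\<integral>\<omega>. f (X \<omega>) \<partial>M))"

end

theory Submission
  imports Defs
begin

text \<open>
  Testing covariate balance against the constant \<open>1\<close> shows that both normalising constants are
  \<open>1\<close>; testing it against indicators \<open>f = 1\<^sub>B\<close> then says that \<open>h\<close> integrates to \<open>0\<close> over every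
  event \<open>{X \<in> B}\<close>, i.e. \<open>E[h | X] = 0\<close>. By the characterising property of the weights,
  \<open>H\<^sub>w\<close> vanishes almost everywhere, hence also \<open>\<Psi>\<close>-almost everywhere.
\<close>

text \<open>Every event of the sigma-algebra generated by \<open>X\<close> is a preimage of some
  \<open>B\<close> in \<open>sets N\<close>, so \<open>zero\<close> says that \<open>g\<close> and
  the constant 0 have the same integral over each such event. This characterises the conditional
  expectation up to null sets.\<close>

lemma (in prob_space) real_cond_exp_vimage_eq_0:
  fixes g :: "'a \<Rightarrow> real" and X :: "'a \<Rightarrow> 'b"
  assumes X: "X \<in> measurable M N"
    and g: "integrable M g"
    and zero: "\<And>B. B \<in> sets N \<Longrightarrow> (\<integral>\<omega>. indicator B (X \<omega>) * g \<omega> \<partial>M) = 0"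
  shows "AE \<omega> in M. real_cond_exp M (vimage_algebra (space M) X N) g \<omega> = 0"
proof -
  let ?F = "vimage_algebra (space M) X N"
  have XN: "X \<in> space M \<rightarrow> space N"
    using X by (auto dest: measurable_space)
  have "subalgebra M ?F"
    using X XN by (auto simp: subalgebra_def sets_vimage_algebra2 measurable_sets)
  then interpret finite_measure_subalgebra M ?F
    by unfold_locales
  show ?thesis
  proof (rule real_cond_exp_charact)
    fix A assume "A \<in> sets ?F"
    then obtain B where B: "B \<in> sets N" and A: "A = X -` B \<inter> space M"
      by (auto simp: sets_vimage_algebra2[OF XN])
    have "(\<integral>\<omega>\<in>A. g \<omega> \<partial>M) = (\<integral>\<omega>. indicator B (X \<omega>) * g \<omega> \<partial>M)"
      unfolding set_lebesgue_integral_def A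
      by (rule Bochner_Integration.integral_cong) (auto simp: indicator_def)
    then show "(\<integral>\<omega>\<in>A. g \<omega> \<partial>M) = (\<integral>\<omega>\<in>A. 0 \<partial>M)"
      using zero[OF B] by simp
  qed (use g in simp_all)
qed

lemma covariate_balance_imp_cond_balance:
  assumes "prob_space M"
    and X: "X \<in> borel_measurable M"
    and bal: "covariate_balance M D X p \<beta>"
  shows "cond_balance M D X p \<beta>"
proof -
  interpret prob_space M by fact
  define g1 where "g1 = (\<lambda>\<omega>. D \<omega> / p (X \<omega>) \<beta>)"
  define g0 where "g0 = (\<lambda>\<omega>. (1 - D \<omega>) / (1 - p (X \<omega>) \<beta>))"
  \<comment> \<open>The two equations of the balancing condition chain, so both unnormalised weights
    satisfy the same identity and the two treatment arms can be handled together.\<close>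
  have bal': "integrable M (\<lambda>\<omega>. g \<omega> * f (X \<omega>))"
      "(\<integral>\<omega>. g \<omega> * f (X \<omega>) \<partial>M) = (\<integral>\<omega>. f (X \<omega>) \<partial>M)"
    if "g \<in> {g1, g0}" "f \<in> borel_measurable borel" "integrable M (\<lambda>\<omega>. f (X \<omega>))" for g f
    using bal[unfolded covariate_balance_def, rule_format, OF that(2,3)] that(1)
    by (auto simp only: g1_def g0_def insert_iff empty_iff)
  have int: "integrable M g" and norm: "(\<integral>\<omega>. g \<omega> \<partial>M) = 1" if "g \<in> {g1, g0}" for g
    using bal'(1)[of g "\<lambda>_. 1", OF that _ integrable_const]
      bal'(2)[of g "\<lambda>_. 1", OF that _ integrable_const] prob_space by simp_all
  have cond: "AE \<omega> in M. real_cond_exp M (vimage_algebra (space M) X borel) (\<lambda>\<omega>. g \<omega> - 1) \<omega> = 0"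
    if g: "g \<in> {g1, g0}" for g
  proof (rule real_cond_exp_vimage_eq_0[OF X])
    show "integrable M (\<lambda>\<omega>. g \<omega> - 1)"
      using int[OF g] by simp
  next
    fix B :: "(real^'b) set" assume B: "B \<in> sets borel"
    \<comment> \<open>An indicator is bounded, hence integrable under a probability measure and
      admissible as a test function.\<close>
    have ind: "integrable M (\<lambda>\<omega>. indicator B (X \<omega>) :: real)"
      by (rule integrable_const_bound[where B=1])
        (simp_all add: measurable_compose[OF X borel_measurable_indicator[OF B]])
    show "(\<integral>\<omega>. indicator B (X \<omega>) * (g \<omega> - 1) \<partial>M) = 0"
      using bal'[OF g borel_measurable_indicator[OF B] ind] ind
      by (simp add: left_diff_distrib mult.commute[of "indicator B (X _)"])
  qed
  \<comment> \<open>The denominators in the normalised weights are the integrals of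
    \<open>g1\<close> and \<open>g0\<close>, both 1 by \<open>norm\<close>, so normalising changes
    nothing.\<close>
  have "balance_h M D X p \<beta> = (\<lambda>\<omega>. vector [g1 \<omega> - 1, g0 \<omega> - 1])"
    using norm[of g1] norm[of g0]
    by (simp add: fun_eq_iff balance_h_def ps_weight1_def ps_weight0_def g1_def g0_def)
  then show ?thesis
    unfolding cond_balance_def forall_2 using cond[of g1] cond[of g0] by simp
qed

theorem lemma2p1:
  fixes M :: "'a measure"
    and D :: "'a \<Rightarrow> real"
    and X :: "'a \<Rightarrow> real^'k"
    and p :: "real^'k \<Rightarrow> real^'k \<Rightarrow> real"
    and \<Theta> :: "(real^'k) set"
    and \<beta>0 :: "real^'k"
    and U :: "'u set"
    and w :: "real^'k \<Rightarrow> 'u \<Rightarrow> complex"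
    and \<mu> \<Psi> :: "'u measure"
  assumes prob: "prob_space M"
    and D_rv: "D \<in> borel_measurable M"
    and D_bin: "\<And>\<omega>. \<omega> \<in> space M \<Longrightarrow> D \<omega> \<in> {0, 1}"
    and X_rv: "X \<in> borel_measurable M"
    and p_meas: "\<And>\<beta>. \<beta> \<in> \<Theta> \<Longrightarrow> (\<lambda>x. p x \<beta>) \<in> borel_measurable borel"
    and p_range: "\<And>x \<beta>. \<beta> \<in> \<Theta> \<Longrightarrow> p x \<beta> \<in> {0<..<1}"
    and int1: "\<And>\<beta>. \<beta> \<in> \<Theta> \<Longrightarrow> integrable M (\<lambda>\<omega>. D \<omega> / p (X \<omega>) \<beta>)"
    and int0: "\<And>\<beta>. \<beta> \<in> \<Theta> \<Longrightarrow> integrable M (\<lambda>\<omega>. (1 - D \<omega>) / (1 - p (X \<omega>) \<beta>))"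
    and w_meas: "\<And>u. u \<in> U \<Longrightarrow> (\<lambda>x. w x u) \<in> borel_measurable borel"
    and int_hw: "\<And>\<beta> u. \<beta> \<in> \<Theta> \<Longrightarrow> u \<in> U \<Longrightarrow> integrable M (weighted_h M D X p w \<beta> u)"
    and space_mu: "space \<mu> = U"
    and w_char: "\<And>\<beta>. \<beta> \<in> \<Theta> \<Longrightarrow>
        cond_balance M D X p \<beta> \<longleftrightarrow> (AE u in \<mu>. H_w M D X p w \<beta> u = 0)"
    and Psi_prob: "prob_space \<Psi>"
    and Psi_sets: "sets \<Psi> = sets \<mu>"
    and Psi_ac: "absolutely_continuous \<mu> \<Psi>"
    and int_Q: "\<And>\<beta>. \<beta> \<in> \<Theta> \<Longrightarrow> integrable \<Psi> (\<lambda>u. (norm (H_w M D X p w \<beta> u))\<^sup>2)"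
    and beta0_in: "\<beta>0 \<in> \<Theta>"
    and beta0_bal: "covariate_balance M D X p \<beta>0"
    and beta0_unique: "\<And>\<beta>. \<beta> \<in> \<Theta> \<Longrightarrow> covariate_balance M D X p \<beta> \<Longrightarrow> \<beta> = \<beta>0"
  shows "(\<forall>\<beta>\<in>\<Theta>. Q_w M D X p w \<Psi> \<beta> \<ge> 0) \<and>
         (Q_w M D X p w \<Psi> \<beta>0 = 0 \<longleftrightarrow> covariate_balance M D X p \<beta>0)"
proof (intro conjI ballI)
  show "Q_w M D X p w \<Psi> \<beta> \<ge> 0" for \<beta>
    by (simp add: Q_w_def)
  have "AE u in \<mu>. H_w M D X p w \<beta>0 u = 0"
    using w_char[OF beta0_in] covariate_balance_imp_cond_balance[OF prob X_rv beta0_bal] by simp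
  \<comment> \<open>Absolute continuity makes every null set of \<open>\<mu>\<close> a null set of
    \<open>\<Psi>\<close>.\<close>
  then have "AE u in \<Psi>. H_w M D X p w \<beta>0 u = 0"
    by (rule absolutely_continuous_AE[OF Psi_sets Psi_ac])
  then have "Q_w M D X p w \<Psi> \<beta>0 = 0"
    unfolding Q_w_def by (intro integral_eq_zero_AE) auto
  \<comment> \<open>Balance at \<open>\<beta>0\<close> is a hypothesis, so both sides of the
    equivalence are true; the implication from \<open>Q_w = 0\<close> to balance rests on that
    hypothesis.\<close>
  with beta0_bal show "Q_w M D X p w \<Psi> \<beta>0 = 0 \<longleftrightarrow> covariate_balance M D X p \<beta>0"
    by simp
qed

end
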